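(* Let $\sigma$ be a switch table for a subgroup $G$ of $\mathrm{Sym}(n)$ of order $k$ with maximal effective row $r$ and $c_i$ non-trivial switches in row $i$, $i=1,2,\dots,r$. Assume that there is a $\mu\in(0,1)$ such that - $m\le\mu(n-r+1)$, - $c_i+1\le\mu(n-i+1-m+1)$ for all $i=1,2,\dots,r$. Then the relative effort $\mathrm{eff}_{\mathrm{mst}}(m)$ of $\sigma$ is at least $\frac32(1-\mu)^{r(m+1)}$, i.e., $$E_{\mathrm{mst}}(m)\ge\frac32(1-\mu)^{r(m+1)}\,km .$$
   Context: Throughout $1\le m<n$, $[n]=\{1,\dots,n\}$. Switch tables. For a subgroup $G\le\mathrm{Sym}(n)$ of order $k$, a switch table is a map $(i,j)\mapsto\sigma_{i,j}\in G$ on $[n]\times[n]$ such that for $j>i$, if some $g\in G$ has $g(j)=i$ and $g(t)=t$ for all $t<i$, then $\sigma_{i,j}$ is one such $g$; otherwise $\sigma_{i,j}=\mathrm{id}$. Non-identity entries are non-trivial; a row is effective if it has a non-trivial entry; $r$ is the largest index of an effective row; $J(i)$ is the set of columns of non-trivial entries in row $i$ and $c_i=|J(i)|$. One has $k=\prod_{j=1}^r(c_j+1)$. Modified switch-table method and cost. A call at level $i$ takes subsets $S,S'\subseteq\{i,\dots,n\}$ with $|S|=|S'|=\ell$; it is started at level $1$ with $\ell=m$. If $\ell=0$, or $i\le r$ and $\ell=n-i+1$, it returns at no cost. If $i=r+1$ and $\ell\ge1$, $S$ and $S'$ are compared lexicographically, counted as $\ell$ single-element evaluations. Otherwise: (element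 branch, $i\in S$) if $i\in S'$, make a call at level $i+1$ with $S\setminus\{i\},S'\setminus\{i\}$; and for each $j\in J(i)\cap S'$ compute $\sigma_{i,j}(S'\setminus\{j\})$ ($\ell-1$ evaluations) and make a call at level $i+1$ with $S\setminus\{i\}$ and this image; (non-element branch, $i\notin S$) if $i\in S'$ or $J(i)\cap S'\ne\emptyset$, return at no cost; otherwise make a call at level $i+1$ with $S,S'$, and for each $j\in J(i)$ compute $\sigma_{i,j}(S')$ ($\ell$ evaluations) and make a call at level $i+1$ with $S$ and this image. A negative answer of a recursive call does not stop the algorithm; all branches are carried out. Typical number $E_{\mathrm{mst}}(m)$: the expected total number of evaluations in the paper's simplified ("hyper-amortized") uniform model, in which in every call at level $i$ with cardinality $\ell$ the two subsets are regarded as independent and uniformly random $\ell$-subsets of $\{i,\dots,n\}$, disregarding their dependence on the subsets of earlier calls. Relative effort: $\mathrm{eff}_{\mathrm{mst}}(m):=E_{\mathrm{mst}}(m)/(km)$, where $km$ is the number of single-element evaluations of the naive method (apply each of the $k$ permutations to all $m$ elements). *)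

theory Defs
  imports "HOL-Probability.Probability" "HOL-Algebra.Sym_Groups"
begin

text \<open>
  Permutations of \<open>[n] = {1..n}\<close> are functions on \<open>nat\<close> that fix everything outside \<open>{1..n}\<close>;
  \<open>sym_group n\<close> is the symmetric group on \<open>{1..n}\<close>.
\<close>

definition switch_table :: "nat \<Rightarrow> (nat \<Rightarrow> nat) set \<Rightarrow> (nat \<Rightarrow> nat \<Rightarrow> nat \<Rightarrow> nat) \<Rightarrow> bool" where
  "switch_table n G \<sigma> \<longleftrightarrow>
     (\<forall>i\<in>{1..n}. \<forall>j\<in>{1..n}.
        if i < j \<and> (\<exists>g\<in>G. g j = i \<and> (\<forall>t\<in>{1..<i}. g t = t))
        then \<sigma> i j \<in> G \<and> \<sigma> i j j = i \<and> (\<forall>t\<in>{1..<i}. \<sigma> i j t = t)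
        else \<sigma> i j = id)"

definition nontriv_cols :: "nat \<Rightarrow> (nat \<Rightarrow> nat \<Rightarrow> nat \<Rightarrow> nat) \<Rightarrow> nat \<Rightarrow> nat set" where
  "nontriv_cols n \<sigma> i = {j\<in>{1..n}. \<sigma> i j \<noteq> id}"

definition num_switches :: "nat \<Rightarrow> (nat \<Rightarrow> nat \<Rightarrow> nat \<Rightarrow> nat) \<Rightarrow> nat \<Rightarrow> nat" where
  "num_switches n \<sigma> i = card (nontriv_cols n \<sigma> i)"

definition effective_row :: "nat \<Rightarrow> (nat \<Rightarrow> nat \<Rightarrow> nat \<Rightarrow> nat) \<Rightarrow> nat \<Rightarrow> bool" where
  "effective_row n \<sigma> i \<longleftrightarrow> i \<in> {1..n} \<and> nontriv_cols n \<sigma> i \<noteq> {}"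

text \<open>No \<open>r\<close> satisfies this if the table has no effective row, i.e. if the group is trivial.\<close>

definition max_effective_row :: "nat \<Rightarrow> (nat \<Rightarrow> nat \<Rightarrow> nat \<Rightarrow> nat) \<Rightarrow> nat \<Rightarrow> bool" where
  "max_effective_row n \<sigma> r \<longleftrightarrow>
     effective_row n \<sigma> r \<and> (\<forall>i. effective_row n \<sigma> i \<longrightarrow> i \<le> r)"

text \<open>
  One call of the modified switch-table method at a level \<open>i \<le> r\<close> that does not return at once:
  the recursive calls it makes at level \<open>i + 1\<close> and the number of single-element evaluations
  it performs itself.
\<close>

definition mst_calls ::
  "nat \<Rightarrow> (nat \<Rightarrow> nat \<Rightarrow> nat \<Rightarrow> nat) \<Rightarrow> nat \<Rightarrow> nat set \<Rightarrow> nat set \<Rightarrow> (nat set \<times> nat set) list" where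
  "mst_calls n \<sigma> i S S' =
     (if i \<in> S then
        (if i \<in> S' then [(S - {i}, S' - {i})] else []) @
        map (\<lambda>j. (S - {i}, \<sigma> i j ` (S' - {j}))) (sorted_list_of_set (nontriv_cols n \<sigma> i \<inter> S'))
      else if i \<in> S' \<or> nontriv_cols n \<sigma> i \<inter> S' \<noteq> {} then []
      else (S, S') # map (\<lambda>j. (S, \<sigma> i j ` S')) (sorted_list_of_set (nontriv_cols n \<sigma> i)))"

definition mst_local_evals ::
  "nat \<Rightarrow> (nat \<Rightarrow> nat \<Rightarrow> nat \<Rightarrow> nat) \<Rightarrow> nat \<Rightarrow> nat set \<Rightarrow> nat set \<Rightarrow> nat" where
  "mst_local_evals n \<sigma> i S S' =
     (if i \<in> S then (\<Sum>j\<in>nontriv_cols n \<sigma> i \<inter> S'. card S - 1)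
      else if i \<in> S' \<or> nontriv_cols n \<sigma> i \<inter> S' \<noteq> {} then 0
      else (\<Sum>j\<in>nontriv_cols n \<sigma> i. card S))"

primrec indep_sum_pmf :: "nat pmf list \<Rightarrow> nat pmf" where
  "indep_sum_pmf [] = return_pmf 0"
| "indep_sum_pmf (p # ps) = bind_pmf p (\<lambda>x. map_pmf (\<lambda>y. x + y) (indep_sum_pmf ps))"

definition subsets_of_card :: "nat \<Rightarrow> nat \<Rightarrow> nat \<Rightarrow> nat set set" where
  "subsets_of_card n i l = {S. S \<subseteq> {i..n} \<and> card S = l}"

text \<open>
  Total number of evaluations caused by a call at level \<open>i\<close> with cardinality \<open>l\<close> in the
  hyper-amortized model: the two subsets of every call are drawn afresh, independently and
  uniformly, so that a recursive call inherits only its level and its cardinality.  Sibling calls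
  are drawn independently of each other; the expectation does not depend on this choice.
  Levels beyond \<open>r + 1\<close> are not reached from level 1.
\<close>

function mst_evals ::
  "nat \<Rightarrow> (nat \<Rightarrow> nat \<Rightarrow> nat \<Rightarrow> nat) \<Rightarrow> nat \<Rightarrow> nat \<Rightarrow> nat \<Rightarrow> nat pmf" where
  "mst_evals n \<sigma> r i l =
     (if l = 0 \<or> (i \<le> r \<and> l = n - i + 1) then return_pmf 0
      else if r < i then return_pmf l
      else bind_pmf
        (pair_pmf (pmf_of_set (subsets_of_card n i l)) (pmf_of_set (subsets_of_card n i l)))
        (\<lambda>(S, S'). map_pmf (\<lambda>x. mst_local_evals n \<sigma> i S S' + x)
           (indep_sum_pmf (map (\<lambda>(T, T'). mst_evals n \<sigma> r (i + 1) (card T))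
              (mst_calls n \<sigma> i S S')))))"
  by pat_completeness auto
termination
  by (relation "Wellfounded.measure (\<lambda>(n, \<sigma>, r, i, l). r + 1 - i)") auto

declare mst_evals.simps [simp del]

definition E_mst :: "nat \<Rightarrow> (nat \<Rightarrow> nat \<Rightarrow> nat \<Rightarrow> nat) \<Rightarrow> nat \<Rightarrow> nat \<Rightarrow> real" where
  "E_mst n \<sigma> r m = measure_pmf.expectation (mst_evals n \<sigma> r 1 m) real"

definition eff_mst :: "nat \<Rightarrow> (nat \<Rightarrow> nat \<Rightarrow> nat \<Rightarrow> nat) \<Rightarrow> nat \<Rightarrow> nat \<Rightarrow> nat \<Rightarrow> real" where
  "eff_mst n \<sigma> r k m = E_mst n \<sigma> r m / (real k * real m)"

end

theory Submission
  imports Defs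
begin

text \<open>
  Only the non-element branch is needed.  At a level \<open>i \<le> r\<close> with \<open>N = n - i + 1\<close> it is carried out
  with probability \<open>(1 - m / N) * ((N - 1 - c\<^sub>i) choose m) / (N choose m)\<close>, which is at least
  \<open>(1 - \<mu>) ^ (m + 1)\<close>, and it keeps the cardinality \<open>m\<close>.  Hence each level contributes a factor
  \<open>(1 - \<mu>) ^ (m + 1) * (c\<^sub>i + 1)\<close>, and the product of the \<open>c\<^sub>i + 1\<close> is the group order.  The factor
  \<open>3 / 2\<close> arises at level \<open>r\<close>, where the applications of the \<open>c\<^sub>r \<ge> 1\<close> switches are counted too:
  \<open>c\<^sub>r m + (c\<^sub>r + 1) m \<ge> 3 / 2 * (c\<^sub>r + 1) m\<close>.
\<close>

subsection \<open>The order of the group\<close>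

text \<open>The stabilizer chain indexed to match the rows of the table: index 1 gives
  \<open>G\<close>, index \<open>n + 1\<close> the trivial group, and row \<open>i\<close> describes
  the passage from \<open>i\<close> to \<open>i + 1\<close>.\<close>

definition pointwise_stabilizer :: "(nat \<Rightarrow> nat) set \<Rightarrow> nat \<Rightarrow> (nat \<Rightarrow> nat) set" where
  "pointwise_stabilizer G i = {g\<in>G. \<forall>t\<in>{1..<i}. g t = t}"

lemma switch_table_nontrivD:
  assumes "switch_table n G \<sigma>" "i \<in> {1..n}" "j \<in> nontriv_cols n \<sigma> i"
  shows "i < j" "j \<le> n" "\<sigma> i j \<in> G" "\<sigma> i j j = i" "\<forall>t\<in>{1..<i}. \<sigma> i j t = t"
proof -
  have j: "j \<in> {1..n}" "\<sigma> i j \<noteq> id"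
    using assms(3) by (auto simp: nontriv_cols_def)
  have "if i < j \<and> (\<exists>g\<in>G. g j = i \<and> (\<forall>t\<in>{1..<i}. g t = t))
        then \<sigma> i j \<in> G \<and> \<sigma> i j j = i \<and> (\<forall>t\<in>{1..<i}. \<sigma> i j t = t)
        else \<sigma> i j = id"
    using assms(1,2) j(1) unfolding switch_table_def by blast
  then have "i < j \<and> \<sigma> i j \<in> G \<and> \<sigma> i j j = i \<and> (\<forall>t\<in>{1..<i}. \<sigma> i j t = t)"
    using j(2) by presburger
  then show "i < j" "\<sigma> i j \<in> G" "\<sigma> i j j = i" "\<forall>t\<in>{1..<i}. \<sigma> i j t = t"
    by blast+
  show "j \<le> n"
    using j(1) by simp
qed

lemma switch_table_nontrivI:
  assumes "switch_table n G \<sigma>" "i \<in> {1..n}" "j \<in> {1..n}" "i < j"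
    and "g \<in> G" "g j = i" "\<forall>t\<in>{1..<i}. g t = t"
  shows "j \<in> nontriv_cols n \<sigma> i"
proof -
  have "\<sigma> i j j = i"
    using assms unfolding switch_table_def by metis
  then show ?thesis
    using assms(3,4) by (auto simp: nontriv_cols_def)
qed

lemma finite_nontriv_cols [simp]: "finite (nontriv_cols n \<sigma> i)"
  by (simp add: nontriv_cols_def)

lemma subgroup_sym_groupD:
  assumes "subgroup G (sym_group n)"
  shows "g \<in> G \<Longrightarrow> g permutes {1..n}" "id \<in> G"
    "g \<in> G \<Longrightarrow> h \<in> G \<Longrightarrow> g \<circ> h \<in> G" "g \<in> G \<Longrightarrow> inv' g \<in> G" "finite G"
proof -
  show perm: "g permutes {1..n}" if "g \<in> G" for g
    using subgroup.mem_carrier[OF assms that] by (simp add: sym_group_def)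
  show "id \<in> G"
    using subgroup.one_closed[OF assms] by (simp add: sym_group_def)
  show "g \<in> G \<Longrightarrow> h \<in> G \<Longrightarrow> g \<circ> h \<in> G"
    using subgroup.m_closed[OF assms] by (simp add: sym_group_def)
  show "inv' g \<in> G" if "g \<in> G"
    using subgroup.m_inv_closed[OF assms that] subgroup.mem_carrier[OF assms that]
    by (simp add: sym_group_inv_equality)
  show "finite G"
    by (rule finite_subset[OF _ finite_permutations[of "{1..n}"]]) (auto dest: perm)
qed

text \<open>The switches of row \<open>i\<close> together with \<open>id\<close> represent the right
  cosets of the next stabilizer: every \<open>g\<close> factors uniquely as
  \<open>h \<circ> s j\<close>, where \<open>j\<close> is the point that \<open>g\<close> sends to
  \<open>i\<close> and \<open>h\<close> fixes \<open>i\<close> as well.\<close>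

lemma card_pointwise_stabilizer_step:
  assumes G: "subgroup G (sym_group n)" and st: "switch_table n G \<sigma>" and i: "i \<in> {1..n}"
  shows "card (pointwise_stabilizer G i) =
    (num_switches n \<sigma> i + 1) * card (pointwise_stabilizer G (Suc i))"
proof -
  note Gs = subgroup_sym_groupD[OF G]
  note nt = switch_table_nontrivD[OF st i]
  let ?J = "nontriv_cols n \<sigma> i"
  \<comment> \<open>Column \<open>i\<close> is added with \<open>id\<close> for the trivial coset;
    this is the \<open>+ 1\<close> in the count.\<close>
  define s where "s j = (if j = i then id else \<sigma> i j)" for j
  have s: "s j \<in> G" "s j j = i" "\<forall>t\<in>{1..<i}. s j t = t" if "j \<in> insert i ?J" for j
    using that nt Gs(2) by (auto simp: s_def)
  have i_notin: "i \<notin> ?J"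
    using nt(1) by blast
  have inj_G: "inj g" if "g \<in> G" for g
    using Gs(1)[OF that] by (rule permutes_inj)
  have bij: "bij_betw (\<lambda>(j, h). h \<circ> s j)
    (insert i ?J \<times> pointwise_stabilizer G (Suc i)) (pointwise_stabilizer G i)"
    unfolding bij_betw_def
  proof (intro conjI equalityI subsetI)
    show "inj_on (\<lambda>(j, h). h \<circ> s j) (insert i ?J \<times> pointwise_stabilizer G (Suc i))"
    proof (rule inj_onI, clarify)
      fix j h j' h'
      assume j: "j \<in> insert i ?J" and j': "j' \<in> insert i ?J"
        and h: "h \<in> pointwise_stabilizer G (Suc i)" and h': "h' \<in> pointwise_stabilizer G (Suc i)"
        and eq: "h \<circ> s j = h' \<circ> s j'"
      \<comment> \<open>Since \<open>h\<close> fixes \<open>i\<close>, the composite sends exactly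
        \<open>j\<close> to \<open>i\<close>. So it determines \<open>j\<close>, and then
        \<open>h\<close> because \<open>s j\<close> is surjective.\<close>
      have "h i = i" "h' i = i"
        using h h' i by (auto simp: pointwise_stabilizer_def)
      then have "(h \<circ> s j) j = i" "(h' \<circ> s j') j' = i"
        by (simp_all add: s(2)[OF j] s(2)[OF j'])
      then have "(h \<circ> s j) j = i" "(h \<circ> s j) j' = i"
        by (simp_all only: eq)
      moreover have "inj (h \<circ> s j)"
        using h j s(1) by (intro inj_compose inj_G) (auto simp: pointwise_stabilizer_def)
      ultimately have "j = j'"
        by (metis injD)
      moreover have "h = h'"
      proof
        fix x
        obtain y where "x = s j y"
          using permutes_surj[OF Gs(1)[OF s(1)[OF j]]] by (metis surjD)
        then show "h x = h' x"
          using fun_cong[OF eq, of y] \<open>j = j'\<close> by simp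
      qed
      ultimately show "j = j' \<and> h = h'"
        by simp
    qed
  next
    fix g assume "g \<in> (\<lambda>(j, h). h \<circ> s j) ` (insert i ?J \<times> pointwise_stabilizer G (Suc i))"
    then obtain j h where "j \<in> insert i ?J" "h \<in> pointwise_stabilizer G (Suc i)" "g = h \<circ> s j"
      by auto
    then show "g \<in> pointwise_stabilizer G i"
      using s(1,3) Gs(3) by (auto simp: pointwise_stabilizer_def)
  next
    fix g assume g: "g \<in> pointwise_stabilizer G i"
    then have gG: "g \<in> G" and fixg: "\<forall>t\<in>{1..<i}. g t = t"
      by (auto simp: pointwise_stabilizer_def)
    obtain j where gj: "g j = i"
      using permutes_surj[OF Gs(1)[OF gG]] by (metis surjD)
    have jn: "j \<in> {1..n}"
      using permutes_in_image[OF Gs(1)[OF gG], of j] gj i by auto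
    have "g j = j" if "j < i"
      using that jn fixg by simp
    \<comment> \<open>A point \<open>j < i\<close> would be fixed by \<open>g\<close>, contrary to
      \<open>g j = i\<close>.\<close>
    then have "j = i \<or> i < j"
      using gj by linarith
    then have j: "j \<in> insert i ?J"
      using switch_table_nontrivI[OF st i jn _ gG gj fixg] by blast
    \<comment> \<open>Forced by \<open>g = h \<circ> s j\<close>. It fixes \<open>i\<close> because
      the inverse of \<open>s j\<close> takes \<open>i\<close> back to \<open>j\<close>, which
      \<open>g\<close> sends to \<open>i\<close>.\<close>
    define h where "h = g \<circ> inv' (s j)"
    have inv_s: "inv' (s j) (s j t) = t" for t
      using inj_G[OF s(1)[OF j]] by simp
    have "h t = t" if "t \<in> {1..<Suc i}" for t
    proof (cases "t = i")
      case True
      have "inv' (s j) i = j"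
        using inv_s[of j] unfolding s(2)[OF j] .
      then show ?thesis
        unfolding h_def comp_apply True using gj by argo
    next
      case False
      then have "t \<in> {1..<i}"
        using that by auto
      then have "s j t = t" "g t = t"
        using s(3)[OF j] fixg by blast+
      then show ?thesis
        using inv_s[of t] by (simp add: h_def)
    qed
    moreover have "h \<in> G"
      unfolding h_def using gG s(1)[OF j] Gs(3,4) by blast
    moreover have "g = h \<circ> s j"
      using inv_s by (auto simp: h_def)
    ultimately show "g \<in> (\<lambda>(j, h). h \<circ> s j) ` (insert i ?J \<times> pointwise_stabilizer G (Suc i))"
      using j by (force simp: pointwise_stabilizer_def)
  qed
  have "card (insert i ?J) = num_switches n \<sigma> i + 1"
    using i_notin by (simp add: num_switches_def)
  then show ?thesis
    using bij_betw_same_card[OF bij] by (simp only: card_cartesian_product)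
qed

text \<open>The one-step factors telescope downwards from \<open>n + 1\<close>, where only
  \<open>id\<close> is left and the product is empty.\<close>

lemma card_pointwise_stabilizer:
  assumes G: "subgroup G (sym_group n)" and st: "switch_table n G \<sigma>"
    and "1 \<le> i" "i \<le> n + 1"
  shows "card (pointwise_stabilizer G i) = (\<Prod>j=i..n. num_switches n \<sigma> j + 1)"
  using assms(4,3)
proof (induction rule: inc_induct)
  case base
  note Gs = subgroup_sym_groupD[OF G]
  have "pointwise_stabilizer G (n + 1) = {id}"
  proof (intro equalityI subsetI)
    fix g assume "g \<in> pointwise_stabilizer G (n + 1)"
    then have "g \<in> G" "\<forall>t\<in>{1..n}. g t = t"
      by (auto simp: pointwise_stabilizer_def)
    then have "g x = x" for x
      using permutes_not_in[OF Gs(1)] by (cases "x \<in> {1..n}") auto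
    then show "g \<in> {id}"
      by auto
  qed (use Gs(2) in \<open>auto simp: pointwise_stabilizer_def\<close>)
  then show ?case
    by simp
next
  case (step i)
  then show ?case
    using card_pointwise_stabilizer_step[OF G st, of i]
    by (simp add: prod.atLeast_Suc_atMost[of i n])
qed

text \<open>Rows beyond \<open>r\<close> have no non-trivial switch and contribute the factor 1, so
  the product over all rows stops at \<open>r\<close>.\<close>

lemma card_eq_prod_num_switches:
  assumes "subgroup G (sym_group n)" "switch_table n G \<sigma>" "max_effective_row n \<sigma> r"
  shows "card G = (\<Prod>j=1..r. num_switches n \<sigma> j + 1)"
proof -
  have "card G = (\<Prod>j=1..n. num_switches n \<sigma> j + 1)"
    using card_pointwise_stabilizer[OF assms(1,2), of 1] by (simp add: pointwise_stabilizer_def)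
  also have "\<dots> = (\<Prod>j=1..r. num_switches n \<sigma> j + 1)"
  proof (rule prod.mono_neutral_right)
    show "{1..r} \<subseteq> {1..n}"
      using assms(3) by (auto simp: max_effective_row_def effective_row_def)
    show "\<forall>j\<in>{1..n} - {1..r}. num_switches n \<sigma> j + 1 = 1"
    proof
      fix j assume "j \<in> {1..n} - {1..r}"
      then have "\<not> effective_row n \<sigma> j" "j \<in> {1..n}"
        using assms(3) by (auto simp: max_effective_row_def)
      then have "nontriv_cols n \<sigma> j = {}"
        by (simp add: effective_row_def)
      then show "num_switches n \<sigma> j + 1 = 1"
        by (simp add: num_switches_def)
    qed
  qed simp
  finally show ?thesis .
qed

subsection \<open>Expected number of evaluations\<close>

lemma expectation_bind_pmf_finite:
  fixes f :: "'a \<Rightarrow> 'b pmf" and h :: "'b \<Rightarrow> real"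
  assumes "finite (set_pmf p)" "\<And>x. x \<in> set_pmf p \<Longrightarrow> finite (set_pmf (f x))"
  shows "measure_pmf.expectation (bind_pmf p f) h =
    measure_pmf.expectation p (\<lambda>x. measure_pmf.expectation (f x) h)"
  using assms
  by (subst pmf_expectation_bind[of "set_pmf p"])
    (auto simp: integral_measure_pmf[of "set_pmf p"])

lemma prob_pair_pmf_Times:
  "measure_pmf.prob (pair_pmf p q) (A \<times> B) = measure_pmf.prob p A * measure_pmf.prob q B"
proof -
  \<comment> \<open>Cutting down to the supports makes both factors countable, as the product rule
    demands, and leaves the probabilities unchanged.\<close>
  have "A \<times> B \<inter> set_pmf (pair_pmf p q) = (A \<inter> set_pmf p) \<times> (B \<inter> set_pmf q)"
    by auto
  then have "measure_pmf.prob (pair_pmf p q) (A \<times> B) =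
    measure_pmf.prob (pair_pmf p q) ((A \<inter> set_pmf p) \<times> (B \<inter> set_pmf q))"
    by (metis measure_Int_set_pmf)
  also have "\<dots> = measure_pmf.prob p (A \<inter> set_pmf p) * measure_pmf.prob q (B \<inter> set_pmf q)"
    by (rule measure_pmf_prob_product) auto
  finally show ?thesis
    by (simp add: measure_Int_set_pmf)
qed

text \<open>Linearity of expectation. Finiteness of the support is proved in the same induction
  because the rule for \<open>bind_pmf\<close> relies on it.\<close>

lemma indep_sum_pmf_expectation:
  assumes "\<And>p. p \<in> set ps \<Longrightarrow> finite (set_pmf p)"
  shows "finite (set_pmf (indep_sum_pmf ps))"
    and "measure_pmf.expectation (indep_sum_pmf ps) real =
      (\<Sum>p\<leftarrow>ps. measure_pmf.expectation p real)"
proof -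
  have "finite (set_pmf (indep_sum_pmf ps)) \<and>
    measure_pmf.expectation (indep_sum_pmf ps) real = (\<Sum>p\<leftarrow>ps. measure_pmf.expectation p real)"
    using assms
  proof (induction ps)
    case (Cons p ps)
    then have fin: "finite (set_pmf p)" "finite (set_pmf (indep_sum_pmf ps))"
      and IH: "measure_pmf.expectation (indep_sum_pmf ps) real =
        (\<Sum>p\<leftarrow>ps. measure_pmf.expectation p real)"
      by auto
    note [simp] = integrable_measure_pmf_finite[OF fin(1)] integrable_measure_pmf_finite[OF fin(2)]
    have "measure_pmf.expectation (indep_sum_pmf (p # ps)) real =
      measure_pmf.expectation p (\<lambda>x. real x + (\<Sum>p\<leftarrow>ps. measure_pmf.expectation p real))"
      using fin by (simp add: expectation_bind_pmf_finite IH)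
    then show ?case
      using fin by simp
  qed simp
  then show "finite (set_pmf (indep_sum_pmf ps))"
    and "measure_pmf.expectation (indep_sum_pmf ps) real =
      (\<Sum>p\<leftarrow>ps. measure_pmf.expectation p real)"
    by auto
qed

text \<open>Outcomes outside \<open>A\<close> contribute at least 0 because \<open>h\<close> is
  non-negative. This is how all but the favourable branch of a call are discarded.\<close>

lemma expectation_bind_pmf_ge:
  fixes h :: "'b \<Rightarrow> real"
  assumes fin: "finite (set_pmf p)" "\<And>x. x \<in> set_pmf p \<Longrightarrow> finite (set_pmf (f x))"
    and h: "\<And>y. h y \<ge> 0"
    and ge: "\<And>x. x \<in> set_pmf p \<Longrightarrow> x \<in> A \<Longrightarrow> measure_pmf.expectation (f x) h \<ge> v"
  shows "measure_pmf.expectation (bind_pmf p f) h \<ge> measure_pmf.prob p A * v"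
proof -
  have "measure_pmf.prob p A * v = measure_pmf.expectation p (\<lambda>x. indicator A x * v)"
    by simp
  also have "\<dots> \<le> measure_pmf.expectation p (\<lambda>x. measure_pmf.expectation (f x) h)"
  proof (rule integral_mono_AE)
    show "AE x in measure_pmf p. indicator A x * v \<le> measure_pmf.expectation (f x) h"
      using ge h by (auto simp: AE_measure_pmf_iff indicator_def intro!: integral_nonneg)
  qed (use fin(1) in \<open>auto intro: integrable_measure_pmf_finite\<close>)
  finally show ?thesis
    using fin by (simp add: expectation_bind_pmf_finite)
qed

section \<open>Uniformly random subsets and finite supports in the model\<close>

lemma finite_subsets_of_card [simp]: "finite (subsets_of_card n i l)"
  by (rule finite_subset[of _ "Pow {i..n}"]) (auto simp: subsets_of_card_def)

lemma card_subsets_of_card: "card (subsets_of_card n i l) = (n + 1 - i) choose l"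
  using n_subsets[of "{i..n}" l] by (simp add: subsets_of_card_def)

lemma subsets_of_card_nonempty: "l \<le> n + 1 - i \<Longrightarrow> subsets_of_card n i l \<noteq> {}"
  using card_subsets_of_card[of n i l] by (metis card.empty not_less zero_less_binomial_iff less_irrefl)

text \<open>The element \<open>i\<close> is either removed from \<open>S\<close> or absent from it.
  Hence the cardinality handed to level \<open>i + 1\<close> is one that subsets of
  \<open>{i + 1..n}\<close> can have.\<close>

lemma mst_calls_card_le:
  assumes "S \<in> subsets_of_card n i l" "(T, T') \<in> set (mst_calls n \<sigma> i S S')"
  shows "card T \<le> n - i"
proof -
  have "T \<subseteq> {i<..n}"
    using assms by (force simp: mst_calls_def subsets_of_card_def order_le_less split: if_splits)
  then have "card T \<le> card {i<..n}"
    by (rule card_mono[rotated]) simp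
  then show ?thesis
    by simp
qed

text \<open>Makes every expectation in the model a finite sum. The bound on \<open>l\<close> keeps
  \<open>subsets_of_card n i l\<close> non-empty, so that \<open>pmf_of_set\<close> has the expected
  support.\<close>

lemma finite_set_pmf_mst_evals:
  assumes "l \<le> n + 1 - i"
  shows "finite (set_pmf (mst_evals n \<sigma> r i l))"
  using assms
proof (induction n \<sigma> r i l rule: mst_evals.induct)
  case (1 n \<sigma> r i l)
  show ?case
  proof (cases "l = 0 \<or> (i \<le> r \<and> l = n - i + 1) \<or> r < i")
    case True
    then show ?thesis
      by (auto simp: mst_evals.simps[of n \<sigma> r i l])
  next
    case False
    let ?X = "subsets_of_card n i l"
    have X: "set_pmf (pmf_of_set ?X) = ?X"
      using subsets_of_card_nonempty[OF 1(2)] by simp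
    have "finite (set_pmf (indep_sum_pmf (map (\<lambda>(T, T'). mst_evals n \<sigma> r (i + 1) (card T))
              (mst_calls n \<sigma> i S S'))))" if "S \<in> ?X" "S' \<in> ?X" for S S'
    proof (rule indep_sum_pmf_expectation(1), clarsimp)
      fix T T' assume T: "(T, T') \<in> set (mst_calls n \<sigma> i S S')"
      then have "card T \<le> n - i"
        using mst_calls_card_le that by blast
      then show "finite (set_pmf (mst_evals n \<sigma> r (Suc i) (card T)))"
        using 1(1)[of "(S, S')" S S' "(T, T')" T T'] False T that X by auto
    qed
    then show ?thesis
      using False X by (auto simp: mst_evals.simps[of n \<sigma> r i l])
  qed
qed

section \<open>Lower bound for a single level\<close>

text \<open>The event is that the non-element branch is taken and does not return at once; the rest
  of the sample space is estimated by 0. The strict bound on \<open>l\<close> excludes the free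
  return for full sets.\<close>

lemma expectation_mst_evals_ge_aux:
  assumes "i \<le> r" "0 < l" "l < n + 1 - i"
  shows "measure_pmf.expectation (mst_evals n \<sigma> r i l) real \<ge>
    measure_pmf.prob (pair_pmf (pmf_of_set (subsets_of_card n i l)) (pmf_of_set (subsets_of_card n i l)))
      ({S. i \<notin> S} \<times> {S'. insert i (nontriv_cols n \<sigma> i) \<inter> S' = {}}) *
    (real (num_switches n \<sigma> i) * real l + real (num_switches n \<sigma> i + 1) *
       measure_pmf.expectation (mst_evals n \<sigma> r (i + 1) l) real)"
proof -
  let ?X = "subsets_of_card n i l"
  let ?rec = "\<lambda>S S'. map (\<lambda>(T, T'). mst_evals n \<sigma> r (i + 1) (card T)) (mst_calls n \<sigma> i S S')"
  have X: "set_pmf (pmf_of_set ?X) = ?X"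
    using subsets_of_card_nonempty[of l n i] assms(3) by simp
  have fin_rec: "finite (set_pmf p)" if "S \<in> ?X" "p \<in> set (?rec S S')" for S S' p
    using that mst_calls_card_le[OF that(1), of _ _ \<sigma> S']
    by (fastforce intro: finite_set_pmf_mst_evals)
  have rec: "finite (set_pmf (indep_sum_pmf (?rec S S')))"
    "measure_pmf.expectation (indep_sum_pmf (?rec S S')) real =
      (\<Sum>p\<leftarrow>?rec S S'. measure_pmf.expectation p real)" if "S \<in> ?X" for S S'
    using indep_sum_pmf_expectation[of "?rec S S'", OF fin_rec[OF that]] by auto
  have eq: "mst_evals n \<sigma> r i l = bind_pmf (pair_pmf (pmf_of_set ?X) (pmf_of_set ?X))
    (\<lambda>(S, S'). map_pmf (\<lambda>x. mst_local_evals n \<sigma> i S S' + x) (indep_sum_pmf (?rec S S')))"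
    using assms by (subst mst_evals.simps) auto
  show ?thesis
    unfolding eq
  proof (rule expectation_bind_pmf_ge, goal_cases)
    case (2 x)
    then show ?case
      using rec(1) X by auto
  next
    case (4 x)
    obtain S S' where x: "x = (S, S')" "S \<in> ?X" "S' \<in> ?X" "i \<notin> S"
        "i \<notin> S'" "nontriv_cols n \<sigma> i \<inter> S' = {}"
      using 4 X by auto
    then have "card S = l"
      by (simp add: subsets_of_card_def)
    define R where "R = indep_sum_pmf (?rec S S')"
    have "finite (set_pmf R)"
      unfolding R_def by (rule rec(1)[OF x(2)])
    note [simp] = integrable_measure_pmf_finite[OF this]
    have "measure_pmf.expectation (map_pmf (\<lambda>x. mst_local_evals n \<sigma> i S S' + x) R) real =
      real (mst_local_evals n \<sigma> i S S') + measure_pmf.expectation R real"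
      by simp
    also have "\<dots> = real (mst_local_evals n \<sigma> i S S') +
      (\<Sum>p\<leftarrow>?rec S S'. measure_pmf.expectation p real)"
      unfolding R_def rec(2)[OF x(2)] ..
    \<comment> \<open>All recursive calls keep \<open>S\<close>, and the model retains only
      \<open>card S = l\<close>, so the sum consists of equal summands.\<close>
    also have "\<dots> = real (num_switches n \<sigma> i) * real l + real (num_switches n \<sigma> i + 1) *
       measure_pmf.expectation (mst_evals n \<sigma> r (i + 1) l) real"
      using x(4-6) \<open>card S = l\<close>
      by (simp add: mst_local_evals_def mst_calls_def num_switches_def comp_def
          sum_list_triv algebra_simps flip: map_replicate_const)
    finally show ?case
      using x(1) by (simp add: R_def)
  qed (use X in auto)
qed

text \<open>The quotient of the binomials is the product of \<open>(N - d - t) / (N - t)\<close>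
  over \<open>t < l\<close>. Each factor is at least \<open>1 - \<mu>\<close>; the worst case
  \<open>t = l - 1\<close> explains the term \<open>N - l + 1\<close> in the hypothesis.\<close>

lemma binomial_diff_ge:
  fixes \<mu> :: real
  assumes "d \<le> N" "l \<le> N" "\<mu> \<le> 1" "real d \<le> \<mu> * (real N - real l + 1)" "0 \<le> \<mu>"
  shows "real ((N - d) choose l) \<ge> (1 - \<mu>) ^ l * real (N choose l)"
proof -
  have "(1 - \<mu>) ^ l * (\<Prod>t=0..<l. real N - real t) = (\<Prod>t=0..<l. (1 - \<mu>) * (real N - real t))"
    by (simp add: prod.distrib)
  also have "\<dots> \<le> (\<Prod>t=0..<l. real (N - d) - real t)"
  proof (rule prod_mono, safe)
    fix t assume t: "t \<in> {0..<l}"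
    then show "0 \<le> (1 - \<mu>) * (real N - real t)"
      using assms by auto
    have "real t \<le> real l - 1"
      using t by auto
    then have "\<mu> * (real N - real l + 1) \<le> \<mu> * (real N - real t)"
      using assms(5) by (intro mult_left_mono) auto
    then show "(1 - \<mu>) * (real N - real t) \<le> real (N - d) - real t"
      using assms(1,4) by (simp add: algebra_simps of_nat_diff)
  qed
  finally show ?thesis
    by (simp add: binomial_gbinomial gbinomial_prod_rev divide_right_mono)
qed

text \<open>By independence the probability of the event splits: the bound on \<open>l\<close>
  yields one factor \<open>1 - \<mu>\<close> for \<open>S\<close> missing \<open>i\<close>, the
  bound on the switches yields \<open>l\<close> factors for \<open>S'\<close> missing
  \<open>i\<close> and all columns of row \<open>i\<close>.\<close>

lemma expectation_mst_evals_ge: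
  fixes \<mu> :: real
  assumes st: "switch_table n G \<sigma>" and i: "1 \<le> i" "i \<le> r" "i \<le> n"
    and l: "0 < l" "l < n + 1 - i" "real l \<le> \<mu> * (real n - real i + 1)"
    and \<mu>: "0 \<le> \<mu>" "\<mu> \<le> 1"
    and c: "real (num_switches n \<sigma> i) + 1 \<le> \<mu> * (real n - real i + 1 - real l + 1)"
  shows "measure_pmf.expectation (mst_evals n \<sigma> r i l) real \<ge> (1 - \<mu>) ^ (l + 1) *
    (real (num_switches n \<sigma> i) * real l + real (num_switches n \<sigma> i + 1) *
       measure_pmf.expectation (mst_evals n \<sigma> r (i + 1) l) real)"
proof -
  let ?X = "subsets_of_card n i l" and ?J = "insert i (nontriv_cols n \<sigma> i)"
  let ?N = "n + 1 - i" and ?d = "num_switches n \<sigma> i + 1"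
  have J: "?J \<subseteq> {i..n}" "i \<notin> nontriv_cols n \<sigma> i"
    using switch_table_nontrivD[OF st, of i] i by fastforce+
  have cJ: "card ?J = ?d"
    using J(2) by (simp add: num_switches_def)
  have d_le: "?d \<le> ?N"
    using card_mono[OF _ J(1)] cJ by simp
  have card_avoid: "card (?X \<inter> {S. B \<inter> S = {}}) = (?N - card B) choose l" if "B \<subseteq> {i..n}" for B
  proof -
    have "?X \<inter> {S. B \<inter> S = {}} = {S. S \<subseteq> {i..n} - B \<and> card S = l}"
      by (auto simp: subsets_of_card_def)
    moreover have "card ({i..n} - B) = ?N - card B"
      using that by (simp add: card_Diff_subset finite_subset)
    ultimately show ?thesis
      by (simp add: n_subsets)
  qed
  \<comment> \<open>Used below with \<open>B = {i}\<close> for \<open>S\<close> and with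
    \<open>B = ?J\<close> for \<open>S'\<close>.\<close>
  have prob: "measure_pmf.prob (pmf_of_set ?X) {S. B \<inter> S = {}} =
    real ((?N - card B) choose l) / real (?N choose l)" if "B \<subseteq> {i..n}" for B
    using card_avoid[OF that] subsets_of_card_nonempty[of l n i] l(2)
    by (simp add: measure_pmf_of_set card_subsets_of_card)
  have pos: "real (?N choose l) > 0"
    using l(2) by simp
  \<comment> \<open>The absorption identity gives the exact probability \<open>1 - l / N\<close> of
    missing one point, so only a single factor \<open>1 - \<mu>\<close> is lost here.\<close>
  have "real (?N - l) * real (?N choose l) = real ?N * real ((?N - 1) choose l)"
    using binomial_absorb_comp[of ?N l] by (metis of_nat_mult)
  moreover have "(1 - \<mu>) * real ?N \<le> real (?N - l)"
    using l i by (simp add: of_nat_diff algebra_simps)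
  ultimately have "(1 - \<mu>) * real ?N * real (?N choose l) \<le> real ?N * real ((?N - 1) choose l)"
    by (metis mult_right_mono of_nat_0_le_iff)
  then have "(1 - \<mu>) * real (?N choose l) \<le> real ((?N - 1) choose l)"
    using i by (simp add: mult.assoc mult.left_commute)
  then have p1: "1 - \<mu> \<le> measure_pmf.prob (pmf_of_set ?X) {S. i \<notin> S}"
    using prob[of "{i}"] i pos by (simp add: pos_le_divide_eq)
  have "(1 - \<mu>) ^ l * real (?N choose l) \<le> real ((?N - ?d) choose l)"
    using d_le l(2) \<mu> c i by (intro binomial_diff_ge) (auto simp: of_nat_diff algebra_simps)
  then have p2: "(1 - \<mu>) ^ l \<le> measure_pmf.prob (pmf_of_set ?X) {S'. ?J \<inter> S' = {}}"
    using prob[OF J(1)] pos by (simp only: cJ pos_le_divide_eq)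
  have "(1 - \<mu>) ^ (l + 1) \<le>
    measure_pmf.prob (pair_pmf (pmf_of_set ?X) (pmf_of_set ?X)) ({S. i \<notin> S} \<times> {S'. ?J \<inter> S' = {}})"
    using mult_mono[OF p1 p2] \<mu>
    unfolding prob_pair_pmf_Times by simp
  then show ?thesis
    by (rule order_trans[OF mult_right_mono expectation_mst_evals_ge_aux])
      (use i l in \<open>auto intro!: add_nonneg_nonneg mult_nonneg_nonneg integral_nonneg\<close>)
qed

section \<open>Chaining the levels\<close>

theorem corollary6:
  fixes n m k r :: nat and G :: "(nat \<Rightarrow> nat) set"
    and \<sigma> :: "nat \<Rightarrow> nat \<Rightarrow> nat \<Rightarrow> nat" and \<mu> :: real
  assumes "1 \<le> m" and "m < n"
    and "subgroup G (sym_group n)" and "card G = k"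
    and "switch_table n G \<sigma>"
    and "max_effective_row n \<sigma> r"
    and "0 < \<mu>" and "\<mu> < 1"
    and "real m \<le> \<mu> * (real n - real r + 1)"
    and "\<And>i. 1 \<le> i \<Longrightarrow> i \<le> r \<Longrightarrow>
           real (num_switches n \<sigma> i) + 1 \<le> \<mu> * (real n - real i + 1 - real m + 1)"
  shows "eff_mst n \<sigma> r k m \<ge> 3 / 2 * (1 - \<mu>) ^ (r * (m + 1)) \<and>
         E_mst n \<sigma> r m \<ge> 3 / 2 * (1 - \<mu>) ^ (r * (m + 1)) * (real k * real m)"
proof -
  let ?c = "num_switches n \<sigma>"
  let ?E = "\<lambda>i. measure_pmf.expectation (mst_evals n \<sigma> r i m) real"
  let ?q = "(1 - \<mu>) ^ (m + 1)"
  have r: "1 \<le> r" "r \<le> n" and cr: "1 \<le> ?c r"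
    using assms(6)
    by (auto simp: max_effective_row_def effective_row_def num_switches_def Suc_le_eq card_gt_0_iff)
  \<comment> \<open>Strictness comes from \<open>\<mu> < 1\<close>: at levels
    \<open>i \<le> r\<close> the cardinality \<open>m\<close> stays below
    \<open>n - i + 1\<close>.\<close>
  have "real m < 1 * (real n - real r + 1)"
    using assms(7,8) r by (intro order.strict_trans1[OF assms(9)] mult_strict_right_mono) auto
  then have "real m < real (n + 1 - r)"
    using r by (simp add: of_nat_diff)
  then have m_less: "m < n + 1 - r"
    by simp
  have step: "?q * (real (?c i) * real m + real (?c i + 1) * ?E (i + 1)) \<le> ?E i"
    if i: "1 \<le> i" "i \<le> r" for i
  proof (rule expectation_mst_evals_ge[OF assms(5)])
    \<comment> \<open>The bound on \<open>m\<close> is assumed at level \<open>r\<close>, where the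
      ground set is smallest, and carries over to earlier levels.\<close>
    have "\<mu> * (real n - real r + 1) \<le> \<mu> * (real n - real i + 1)"
      using i assms(7) by (intro mult_left_mono) auto
    then show "real m \<le> \<mu> * (real n - real i + 1)"
      using assms(9) by linarith
  qed (use i r m_less assms in auto)
  have bound: "3 / 2 * ?q ^ (Suc r - i) * real (\<Prod>j=i..r. ?c j + 1) * real m \<le> ?E i"
    if "i \<le> r" "1 \<le> i" for i
    using that
  proof (induction rule: inc_induct)
    case base
    \<comment> \<open>The final lexicographic comparison at level \<open>r + 1\<close> always costs
      \<open>m\<close>.\<close>
    have last: "?E (r + 1) = real m"
      using assms(1) by (simp add: mst_evals.simps)
    \<comment> \<open>With \<open>c = ?c r\<close> this is
      \<open>3 / 2 * (c + 1) \<le> 2 * c + 1\<close>, equivalent to \<open>c \<ge> 1\<close> and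
      sharp there.\<close>
    have "3 / 2 * real (?c r + 1) * real m \<le> real (?c r) * real m + real (?c r + 1) * real m"
      unfolding distrib_right[symmetric] using cr by (intro mult_right_mono) auto
    then have "?q * (3 / 2 * real (?c r + 1) * real m) \<le>
        ?q * (real (?c r) * real m + real (?c r + 1) * ?E (r + 1))"
      unfolding last using assms(8) by (intro mult_left_mono) auto
    also have "\<dots> \<le> ?E r"
      by (rule step) (use r in auto)
    finally show ?case
      by (simp add: mult_ac del: power_Suc of_nat_Suc of_nat_add)
  next
    case (step i)
    note IH = step(3)
    have P: "real (\<Prod>j=i..r. ?c j + 1) = real (?c i + 1) * real (\<Prod>j=Suc i..r. ?c j + 1)"
      using step(2) by (simp only: prod.atLeast_Suc_atMost[of i r] order_less_imp_le of_nat_mult)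
    have "3 / 2 * ?q ^ (Suc r - i) * real (\<Prod>j=i..r. ?c j + 1) * real m =
      ?q * (real (?c i + 1) * (3 / 2 * ?q ^ (Suc r - Suc i) * real (\<Prod>j=Suc i..r. ?c j + 1) * real m))"
      unfolding P using step(2) by (simp add: Suc_diff_le[of i r])
    also have "\<dots> \<le> ?q * (real (?c i + 1) * ?E (Suc i))"
      using IH step assms(8) by (intro mult_left_mono) auto
    \<comment> \<open>Before level \<open>r\<close> the cost of applying the switches is dropped; it
      is only non-negativity that enters.\<close>
    also have "\<dots> \<le> ?q * (real (?c i) * real m + real (?c i + 1) * ?E (i + 1))"
      using assms(8) by (intro mult_left_mono) auto
    also have "\<dots> \<le> ?E i"
      \<comment> \<open>This is the one-level inequality established before the induction, cited by
        its shape because \<open>step\<close> now denotes the facts of the induction case.\<close>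
      using \<open>1 \<le> i\<close> \<open>i < r\<close> by (intro \<open>\<And>i. 1 \<le> i \<Longrightarrow> i \<le> r \<Longrightarrow> _ \<le> ?E i\<close>) auto
    finally show ?case .
  qed
  have k: "k = (\<Prod>j=1..r. ?c j + 1)"
    using card_eq_prod_num_switches[OF assms(3,5,6)] assms(4) by simp
  have "?q ^ r = (1 - \<mu>) ^ (r * (m + 1))"
    by (subst power_mult[symmetric]) (simp only: mult.commute)
  then have E: "3 / 2 * (1 - \<mu>) ^ (r * (m + 1)) * (real k * real m) \<le> E_mst n \<sigma> r m"
    using bound[of 1] r unfolding E_mst_def k by (simp add: mult.assoc)
  have "0 < k"
    unfolding k by (intro prod_pos) auto
  then show ?thesis
    using E assms(1) by (simp add: eff_mst_def pos_le_divide_eq)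
qed

end
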